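(* Let $\tau$ be a unital completely positive normal map on a von Neumann algebra $\mathcal{A}_0$ acting on a separable Hilbert space $\mathcal{H}_0$, and let $(l_k)_{k\ge 1}$ be a countable family of bounded operators on $\mathcal{H}_0$ such that $\tau(x)=\sum_k l_k^* x l_k$ for all $x\in\mathcal{A}_0$. Let $p\in\mathcal{A}_0$ be a projection. Then $p$ is sub-harmonic for $\tau$ if and only if $(1-p)l_k p=0$ for all $k\ge 1$. Moreover, if $p$ is a sub-harmonic projection for $\tau$, $y=\mathrm{s.lim}_{n\to\infty}\tau_n(p)$, and $z$ is a bounded operator on $\mathcal{H}_0$, then $yz=0$ if and only if $p\,l_{i_1}l_{i_2}\cdots l_{i_n}z=0$ for all $n\ge 1$ and all indices $i_1,\dots,i_n\ge 1$.
   Context: $\tau_n=\tau\circ\cdots\circ\tau$ denotes the $n$-fold composition of $\tau$. A projection $p\in\mathcal{A}_0$ is sub-harmonic for $\tau$ if $\tau(p)\ge p$ (equivalently $\tau_n(p)\ge p$ for all $n\ge 0$). For such $p$ the operators $\tau_n(p)$ are increasing in $n$ and bounded by $1$, so the strong limit $y$ exists and $0\le y\le 1$. *)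

theory Defs
  imports "HOL-Analysis.Analysis"
begin

text \<open>
  Complex Hilbert spaces.  The complex inner product is conjugate-linear in its first argument;
  the axiom \<open>inner_eq_Re_cinner\<close> says that the norm is the one it induces (so positive
  definiteness of \<open>cinner\<close> is inherited from \<^class>\<open>real_inner\<close>).
\<close>

class complex_hilbert_space = real_inner + complete_space +
  fixes scaleC :: "complex \<Rightarrow> 'a \<Rightarrow> 'a" (infixr "*\<^sub>C" 75)
    and cinner :: "'a \<Rightarrow> 'a \<Rightarrow> complex"
  assumes scaleC_add_right: "a *\<^sub>C (x + y) = a *\<^sub>C x + a *\<^sub>C y"
    and scaleC_add_left: "(a + b) *\<^sub>C x = a *\<^sub>C x + b *\<^sub>C x"
    and scaleC_scaleC: "a *\<^sub>C b *\<^sub>C x = (a * b) *\<^sub>C x"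
    and scaleC_of_real: "complex_of_real r *\<^sub>C x = r *\<^sub>R x"
    and cinner_commute: "cinner x y = cnj (cinner y x)"
    and cinner_add_right: "cinner x (y + z) = cinner x y + cinner x z"
    and cinner_scaleC_right: "cinner x (a *\<^sub>C y) = a * cinner x y"
    and inner_eq_Re_cinner: "inner x y = Re (cinner x y)"

text \<open>
  The type \<open>'h \<Rightarrow>\<^sub>L 'h\<close> consists of the bounded real-linear operators; the set
  \<open>bounded_ops\<close> is the algebra of all bounded (complex-linear) operators.
\<close>

type_synonym 'h operator = "'h \<Rightarrow>\<^sub>L 'h"

definition bounded_ops :: "'h::complex_hilbert_space operator set" where
  "bounded_ops = {T :: 'h operator. \<forall>c h. T (c *\<^sub>C h) = c *\<^sub>C T h}"

definition op_scaleC :: "complex \<Rightarrow> 'h::complex_hilbert_space operator \<Rightarrow> 'h operator" where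
  "op_scaleC c T = Blinfun (\<lambda>h. c *\<^sub>C T h)"

definition adj :: "'h::complex_hilbert_space operator \<Rightarrow> 'h operator" where
  "adj T = (THE S :: 'h operator. \<forall>g h. cinner (S g) h = cinner g (T h))"

definition op_pos :: "'h::complex_hilbert_space operator \<Rightarrow> bool" where
  "op_pos T \<longleftrightarrow> (\<forall>h. cinner h (T h) \<in> \<real>\<^sub>\<ge>\<^sub>0)"

definition op_le :: "'h::complex_hilbert_space operator \<Rightarrow> 'h operator \<Rightarrow> bool" where
  "op_le S T \<longleftrightarrow> op_pos (T - S)"

text \<open>Positivity of the operator matrix \<open>(X i j)\<close>, \<open>i, j < n\<close>, acting on the \<open>n\<close>-fold direct sum.\<close>

definition matrix_pos :: "nat \<Rightarrow> (nat \<Rightarrow> nat \<Rightarrow> 'h::complex_hilbert_space operator) \<Rightarrow> bool" where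
  "matrix_pos n X \<longleftrightarrow>
     (\<forall>h :: nat \<Rightarrow> 'h. (\<Sum>i<n. cinner (h i) (\<Sum>j<n. X i j (h j))) \<in> \<real>\<^sub>\<ge>\<^sub>0)"

definition projection :: "'h::complex_hilbert_space operator \<Rightarrow> bool" where
  "projection p \<longleftrightarrow> p \<in> bounded_ops \<and> p o\<^sub>L p = p \<and> adj p = p"

definition von_neumann_algebra :: "'h::complex_hilbert_space operator set \<Rightarrow> bool" where
  "von_neumann_algebra A \<longleftrightarrow>
     A \<subseteq> bounded_ops \<and>
     id_blinfun \<in> A \<and>
     (\<forall>S\<in>A. \<forall>T\<in>A. S + T \<in> A) \<and>
     (\<forall>c. \<forall>T\<in>A. op_scaleC c T \<in> A) \<and>
     (\<forall>S\<in>A. \<forall>T\<in>A. S o\<^sub>L T \<in> A) \<and>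
     (\<forall>T\<in>A. adj T \<in> A) \<and>
     closedin strong_operator_topology A"

definition linear_map_on ::
  "'h::complex_hilbert_space operator set \<Rightarrow> ('h operator \<Rightarrow> 'h operator) \<Rightarrow> bool" where
  "linear_map_on A \<tau> \<longleftrightarrow>
     \<tau> ` A \<subseteq> A \<and>
     (\<forall>S\<in>A. \<forall>T\<in>A. \<tau> (S + T) = \<tau> S + \<tau> T) \<and>
     (\<forall>c. \<forall>T\<in>A. \<tau> (op_scaleC c T) = op_scaleC c (\<tau> T))"

definition completely_positive_on ::
  "'h::complex_hilbert_space operator set \<Rightarrow> ('h operator \<Rightarrow> 'h operator) \<Rightarrow> bool" where
  "completely_positive_on A \<tau> \<longleftrightarrow>
     (\<forall>n X. (\<forall>i<n. \<forall>j<n. X i j \<in> A) \<and> matrix_pos n X \<longrightarrow> matrix_pos n (\<lambda>i j. \<tau> (X i j)))"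

definition selfadjoint_part ::
  "'h::complex_hilbert_space operator set \<Rightarrow> 'h operator set" where
  "selfadjoint_part A = {T\<in>A. adj T = T}"

definition is_op_sup ::
  "'h::complex_hilbert_space operator set \<Rightarrow> 'h operator set \<Rightarrow> 'h operator \<Rightarrow> bool" where
  "is_op_sup A D s \<longleftrightarrow>
     s \<in> selfadjoint_part A \<and>
     (\<forall>T\<in>D. op_le T s) \<and>
     (\<forall>u\<in>selfadjoint_part A. (\<forall>T\<in>D. op_le T u) \<longrightarrow> op_le s u)"

text \<open>
  Normality: preservation of suprema of bounded increasing nets of self-adjoint elements.  The
  nets are represented by their ranges, which are upward directed sets.
\<close>

definition normal_on ::
  "'h::complex_hilbert_space operator set \<Rightarrow> ('h operator \<Rightarrow> 'h operator) \<Rightarrow> bool" where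
  "normal_on A \<tau> \<longleftrightarrow>
     (\<forall>D s. D \<subseteq> selfadjoint_part A \<and> D \<noteq> {} \<and>
        (\<forall>S\<in>D. \<forall>T\<in>D. \<exists>U\<in>D. op_le S U \<and> op_le T U) \<and>
        is_op_sup A D s \<longrightarrow> is_op_sup A (\<tau> ` D) (\<tau> s))"

definition subharmonic ::
  "('h::complex_hilbert_space operator \<Rightarrow> 'h operator) \<Rightarrow> 'h operator \<Rightarrow> bool" where
  "subharmonic \<tau> p \<longleftrightarrow> op_le p (\<tau> p)"

end

theory Submission
  imports Defs
begin

text \<open>
  Everything is read off quadratic forms.  The Kraus decomposition says
  \<open>\<langle>u, \<tau>(x) v\<rangle> = \<Sum>\<^sub>k \<langle>l\<^sub>k u, x l\<^sub>k v\<rangle>\<close>.  When \<open>x \<ge> 0\<close> and \<open>u = v\<close>, this is a series of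
  nonnegative terms, so \<open>\<langle>v, \<tau>(x) v\<rangle>\<close> vanishes if and only if each \<open>\<langle>l\<^sub>k v, x l\<^sub>k v\<rangle>\<close> does.

  Apply this to \<open>x = 1 - p\<close>, for which \<open>\<tau>(1 - p) = 1 - \<tau>(p)\<close> since \<open>\<tau>\<close> is unital.  If
  \<open>\<tau>(p) \<ge> p\<close>, then \<open>\<langle>p v, \<tau>(1 - p) p v\<rangle> \<le> 0\<close>, so \<open>\<parallel>(1 - p) l\<^sub>k p v\<parallel>\<^sup>2\<close>, a term of a
  nonnegative series with sum \<open>\<le> 0\<close>, is zero.  Conversely, if every \<open>(1 - p) l\<^sub>k p\<close> is zero,
  then \<open>\<tau>(1 - p) p = 0\<close>, that is \<open>\<tau>(p) p = p\<close>; the positive operator \<open>\<tau>(p)\<close> is then block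
  diagonal with respect to \<open>p\<close>, with first block \<open>p\<close>, hence \<open>\<tau>(p) \<ge> p\<close>.

  Iterating the vanishing criterion, \<open>\<langle>v, \<tau>\<^sub>n(p) v\<rangle> = 0\<close> if and only if
  \<open>p l\<^sub>i\<^sub>1 \<dots> l\<^sub>i\<^sub>n v = 0\<close> for all words of length \<open>n\<close>.  For sub-harmonic \<open>p\<close> these forms increase
  with \<open>n\<close> to \<open>\<langle>v, y v\<rangle>\<close>, so \<open>\<langle>v, y v\<rangle> = 0\<close> if and only if they all vanish for \<open>n \<ge> 1\<close>; and
  \<open>\<langle>v, y v\<rangle> = 0\<close> means \<open>y v = 0\<close>, because \<open>y\<close> is positive.  Take \<open>v = z h\<close>.

  Using the hypothesis on the Kraus operators requires knowing that the definite
  description in the definition of the adjoint denotes, which rests on the Riesz representation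
  theorem.  A complex-linear operator has the same adjoint for the complex inner product as
  for its real part, so it is enough to prove that theorem for real Hilbert spaces, and the
  argument above needs only the real inner product.
\<close>

section \<open>The Riesz representation theorem\<close>

lemma linear_coeff_zero_if_quadratic_nonneg:
  fixes b c :: real
  assumes "\<And>t. 0 \<le> 2 * t * b + t\<^sup>2 * c"
  shows "b = 0"
proof (rule ccontr)
  assume b: "b \<noteq> 0"
  \<comment> \<open>At \<open>t = -b/s\<close> the form equals \<open>b\<^sup>2 (c - 2 s) / s\<^sup>2\<close>, so any \<open>s > max 0 (c/2)\<close> refutes it.\<close>
  define s where "s = \<bar>c\<bar> + 1"
  have s: "s > 0" "c < 2 * s" by (auto simp: s_def)
  have "0 \<le> s\<^sup>2 * (2 * (- b / s) * b + (- b / s)\<^sup>2 * c)"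
    using assms[of "- b / s"] by (intro mult_nonneg_nonneg) auto
  also have "\<dots> = b\<^sup>2 * (c - 2 * s)"
    using s(1) by (simp add: field_simps power2_eq_square)
  also have "\<dots> < 0"
    using b s(2) by (intro mult_pos_neg) auto
  finally show False by simp
qed

text \<open>
  The representing vector is the minimiser of \<open>x \<mapsto> \<parallel>x\<parallel>\<^sup>2 - 2 f x\<close>.  By the parallelogram law
  this functional is so convex that every minimising sequence is Cauchy; its first variation
  at the minimiser is the desired identity.
\<close>

lemma riesz_representation:
  fixes f :: "'a::{real_inner, complete_space} \<Rightarrow> real"
  assumes f: "bounded_linear f"
  shows "\<exists>a. \<forall>h. inner a h = f h"
proof -
  interpret f: bounded_linear f by fact
  define J where "J x = (norm x)\<^sup>2 - 2 * f x" for x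
  obtain K where K: "\<And>x. norm (f x) \<le> norm x * K" using f.bounded by auto
  have below: "- K\<^sup>2 \<le> J x" for x
  proof -
    have "f x \<le> norm x * K" using K[of x] by simp
    moreover have "0 \<le> (norm x - K)\<^sup>2" by simp
    ultimately show ?thesis by (simp add: J_def power2_diff)
  qed
  then have bdd: "bdd_below (range J)" by (intro bdd_belowI[of _ "- K\<^sup>2"]) auto
  define m where "m = Inf (range J)"
  have m_le: "m \<le> J x" for x unfolding m_def using bdd by (intro cInf_lower) auto
  have "\<exists>x. J x < m + 1 / Suc n" for n
    using cInf_lessD[of "range J" "m + 1 / Suc n"] by (auto simp: m_def)
  then obtain X where X: "\<And>n. J (X n) < m + 1 / Suc n" by metis
  have parallelogram: "(norm (x - y))\<^sup>2 = 2 * J x + 2 * J y - 4 * J ((1/2) *\<^sub>R (x + y))" for x y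
    by (simp add: J_def power2_norm_eq_inner f.scaleR f.add inner_simps inner_commute
        algebra_simps)
  have X_dist: "(norm (X i - X j))\<^sup>2 \<le> 4 / Suc N" if "N \<le> i" "N \<le> j" for i j N
  proof -
    have "1 / real (Suc i) \<le> 1 / Suc N" "1 / real (Suc j) \<le> 1 / Suc N"
      using that by (auto intro!: divide_left_mono)
    with X[of i] X[of j] m_le[of "(1/2) *\<^sub>R (X i + X j)"] show ?thesis
      unfolding parallelogram by simp
  qed
  have "Cauchy X"
  proof (rule metric_CauchyI)
    fix e :: real assume e: "0 < e"
    obtain N where N: "4 / e\<^sup>2 < real N" using reals_Archimedean2 by blast
    have "4 < real (Suc N) * e\<^sup>2"
      using N e by (simp add: divide_less_eq) (smt (verit) zero_less_power mult_less_cancel_right)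
    then have N': "4 / Suc N < e\<^sup>2" by (simp add: divide_less_eq mult.commute)
    have "dist (X i) (X j) < e" if "N \<le> i" "N \<le> j" for i j
      using X_dist[OF that] N' e
      by (metis dist_norm le_less_trans less_eq_real_def power_less_imp_less_base)
    then show "\<exists>M. \<forall>i\<ge>M. \<forall>j\<ge>M. dist (X i) (X j) < e" by blast
  qed
  then obtain a where a: "X \<longlonglongrightarrow> a"
    using Cauchy_convergent convergent_def by blast
  have "(\<lambda>n. J (X n)) \<longlonglongrightarrow> J a"
    unfolding J_def by (intro tendsto_intros a f.tendsto)
  moreover have "(\<lambda>n. m + 1 / Suc n) \<longlonglongrightarrow> m"
    using tendsto_add[OF tendsto_const LIMSEQ_Suc[OF lim_1_over_n], of m] by simp
  ultimately have Ja: "J a \<le> m"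
    by (rule LIMSEQ_le) (use X less_imp_le in blast)
  have "inner a h - f h = 0" for h
  proof (rule linear_coeff_zero_if_quadratic_nonneg)
    fix t
    have "J a \<le> J (a + t *\<^sub>R h)" using Ja m_le order_trans by blast
    then show "0 \<le> 2 * t * (inner a h - f h) + t\<^sup>2 * inner h h"
      by (simp add: J_def power2_norm_eq_inner f.scaleR f.add inner_simps inner_commute
          power2_eq_square[of t] algebra_simps)
  qed
  then show ?thesis by auto
qed

lemma adjoint_exists:
  fixes T :: "'a::{real_inner, complete_space} \<Rightarrow>\<^sub>L 'a"
  shows "\<exists>S :: 'a \<Rightarrow>\<^sub>L 'a. \<forall>g h. inner (S g) h = inner g (T h)"
proof -
  have "\<exists>a. \<forall>h. inner a h = inner g (T h)" for g
    by (intro riesz_representation bounded_linear_intros)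
  then obtain S where S: "\<And>g h. inner (S g) h = inner g (T h)" by metis
  have "bounded_linear S"
  proof (rule bounded_linear_intro)
    show "S (x + y) = S x + S y" for x y
      by (rule vector_eq_rdot[THEN iffD1]) (simp add: S inner_simps)
    show "S (r *\<^sub>R x) = r *\<^sub>R S x" for r x
      by (rule vector_eq_rdot[THEN iffD1]) (simp add: S inner_simps)
    show "norm (S x) \<le> norm x * norm T" for x
    proof (cases "S x = 0")
      case False
      have "norm (S x) * norm (S x) = inner x (T (S x))"
        by (simp flip: S add: power2_norm_eq_inner power2_eq_square[symmetric])
      also have "\<dots> \<le> norm x * norm (T (S x))" by (rule norm_cauchy_schwarz)
      also have "\<dots> \<le> norm x * (norm T * norm (S x))"
        by (intro mult_left_mono norm_blinfun) auto
      finally show ?thesis using False by (simp add: mult.assoc[symmetric])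
    qed simp
  qed
  then show ?thesis
    by (intro exI[of _ "Blinfun S"]) (simp add: bounded_linear_Blinfun_apply S)
qed

section \<open>From the complex to the real inner product\<close>

lemma bounded_opsD: "T \<in> bounded_ops \<Longrightarrow> T (c *\<^sub>C h) = c *\<^sub>C T h"
  by (simp add: bounded_ops_def)

lemma Im_cinner: "Im (cinner g h) = inner g ((- \<i>) *\<^sub>C h)"
  for g h :: "'h::complex_hilbert_space"
  by (simp add: inner_eq_Re_cinner cinner_scaleC_right)

lemma Im_cinner': "Im (cinner g h) = - inner g (\<i> *\<^sub>C h)"
  for g h :: "'h::complex_hilbert_space"
  by (simp add: inner_eq_Re_cinner cinner_scaleC_right)

lemma inner_i_scaleC_left: "inner (\<i> *\<^sub>C g) h = - inner g (\<i> *\<^sub>C h)"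
  for g h :: "'h::complex_hilbert_space"
proof -
  have "inner (\<i> *\<^sub>C g) h = Re (cinner h (\<i> *\<^sub>C g))"
    by (simp add: inner_commute flip: inner_eq_Re_cinner)
  also have "\<dots> = - Im (cinner h g)" by (simp add: cinner_scaleC_right)
  also have "\<dots> = Im (cinner g h)" by (subst cinner_commute) simp
  finally show ?thesis by (simp add: Im_cinner')
qed

lemma inner_adj:
  fixes T :: "'h::complex_hilbert_space operator"
  assumes T: "T \<in> bounded_ops"
  shows "inner (adj T g) h = inner g (T h)"
proof -
  obtain S :: "'h operator" where S: "\<And>g h. inner (S g) h = inner g (T h)"
    using adjoint_exists[of T] by blast
  have S': "cinner (S g) h = cinner g (T h)" for g h
    by (rule complex_eqI)
       (simp_all add: Im_cinner S bounded_opsD[OF T] flip: inner_eq_Re_cinner)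
  have "adj T = S"
    unfolding adj_def
  proof (rule the_equality)
    fix R :: "'h operator" assume R: "\<forall>g h. cinner (R g) h = cinner g (T h)"
    show "R = S"
    proof (rule blinfun_eqI)
      fix g
      show "R g = S g"
        by (rule vector_eq_rdot[THEN iffD1]) (simp add: R S' inner_eq_Re_cinner)
    qed
  qed (simp add: S')
  then show ?thesis by (simp add: S)
qed

definition positive_operator :: "('a::real_inner \<Rightarrow>\<^sub>L 'a) \<Rightarrow> bool" where
  "positive_operator T \<longleftrightarrow>
    (\<forall>u v. inner u (T v) = inner (T u) v) \<and> (\<forall>v. 0 \<le> inner v (T v))"

lemma positive_operator_sym: "positive_operator T \<Longrightarrow> inner u (T v) = inner (T u) v"
  and positive_operator_nonneg: "positive_operator T \<Longrightarrow> 0 \<le> inner v (T v)"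
  by (auto simp: positive_operator_def)

text \<open>
  Symmetry makes \<open>\<langle>h, T h\<rangle>\<close> real: its imaginary part is \<open>-\<langle>h, T (\<i> h)\<rangle>\<close> and also
  \<open>\<langle>\<i> h, T h\<rangle>\<close> in the real inner product, and symmetry equates the latter to \<open>\<langle>h, T (\<i> h)\<rangle>\<close>.
\<close>

lemma op_pos_iff_inner_nonneg:
  fixes T :: "'h::complex_hilbert_space operator"
  assumes T: "T \<in> bounded_ops" and sym: "\<And>u v. inner u (T v) = inner (T u) v"
  shows "op_pos T \<longleftrightarrow> (\<forall>h. 0 \<le> inner h (T h))"
proof -
  have "Im (cinner h (T h)) = 0" for h
  proof -
    have "inner h (\<i> *\<^sub>C T h) = inner (\<i> *\<^sub>C h) (T h)"
      by (metis sym bounded_opsD[OF T] inner_commute)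
    then show ?thesis by (simp add: Im_cinner' inner_i_scaleC_left)
  qed
  then show ?thesis
    by (simp add: op_pos_def complex_nonneg_Reals_iff inner_eq_Re_cinner)
qed

lemma bounded_ops_diff: "S \<in> bounded_ops \<Longrightarrow> T \<in> bounded_ops \<Longrightarrow> S - T \<in> bounded_ops"
  for S T :: "'h::complex_hilbert_space operator"
proof -
  have "c *\<^sub>C (x - y) = c *\<^sub>C x - c *\<^sub>C y" for c and x y :: 'h
    by (metis add_diff_cancel_right' diff_add_cancel scaleC_add_right)
  then show "S \<in> bounded_ops \<Longrightarrow> T \<in> bounded_ops \<Longrightarrow> S - T \<in> bounded_ops"
    by (simp add: bounded_ops_def blinfun.diff_left)
qed

section \<open>Positive operators and projections\<close>

text \<open>
  The form \<open>\<langle>w, T w\<rangle>\<close> attains its minimum \<open>0\<close> at \<open>v\<close>, so its first variation there vanishes.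
\<close>

lemma positive_operator_kernel:
  fixes T :: "'a::real_inner \<Rightarrow>\<^sub>L 'a"
  assumes T: "positive_operator T"
  shows "T v = 0 \<longleftrightarrow> inner v (T v) = 0"
proof
  assume v: "inner v (T v) = 0"
  have "inner w (T v) = 0" for w
  proof (rule linear_coeff_zero_if_quadratic_nonneg)
    fix t
    have "0 \<le> inner (v + t *\<^sub>R w) (T (v + t *\<^sub>R w))"
      by (rule positive_operator_nonneg[OF T])
    moreover have "inner v (T w) = inner w (T v)"
      by (simp add: positive_operator_sym[OF T, of v w] inner_commute)
    ultimately show "0 \<le> 2 * t * inner w (T v) + t\<^sup>2 * inner w (T w)"
      using v by (simp add: blinfun.add_right blinfun.scaleR_right inner_simps
          power2_eq_square algebra_simps)
  qed
  then show "T v = 0" using inner_eq_zero_iff by blast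
qed simp

lemma positive_operator_limit:
  fixes T :: "'a::real_inner \<Rightarrow>\<^sub>L 'a"
  assumes "\<And>n. positive_operator (S n)"
    and lim: "\<And>v. (\<lambda>n. S n v) \<longlonglongrightarrow> T v"
  shows "positive_operator T"
  unfolding positive_operator_def
proof (intro conjI allI)
  fix u v
  have "(\<lambda>n. inner u (S n v)) \<longlonglongrightarrow> inner u (T v)"
    by (intro tendsto_intros lim)
  moreover have "(\<lambda>n. inner u (S n v)) \<longlonglongrightarrow> inner (T u) v"
    unfolding positive_operator_sym[OF assms(1)] by (intro tendsto_intros lim)
  ultimately show "inner u (T v) = inner (T u) v" by (rule LIMSEQ_unique)
next
  fix v
  have "(\<lambda>n. inner v (S n v)) \<longlonglongrightarrow> inner v (T v)"
    by (intro tendsto_intros lim)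
  then show "0 \<le> inner v (T v)"
    by (rule LIMSEQ_le_const) (use positive_operator_nonneg[OF assms(1)] in blast)
qed

definition orthogonal_projection :: "('a::real_inner \<Rightarrow>\<^sub>L 'a) \<Rightarrow> bool" where
  "orthogonal_projection p \<longleftrightarrow>
    (\<forall>u v. inner u (p v) = inner (p u) v) \<and> (\<forall>v. p (p v) = p v)"

lemma orthogonal_projection_sym: "orthogonal_projection p \<Longrightarrow> inner u (p v) = inner (p u) v"
  and orthogonal_projection_idem: "orthogonal_projection p \<Longrightarrow> p (p v) = p v"
  by (auto simp: orthogonal_projection_def)

lemma orthogonal_projection_form:
  fixes p :: "'a::real_inner \<Rightarrow>\<^sub>L 'a"
  assumes "orthogonal_projection p"
  shows "inner v (p v) = (norm (p v))\<^sup>2"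
    and "inner v (v - p v) = (norm (v - p v))\<^sup>2"
  using orthogonal_projection_idem[OF assms, of v] orthogonal_projection_sym[OF assms, of v "p v"]
  by (simp_all add: power2_norm_eq_inner inner_simps inner_commute)

lemma orthogonal_projection_positive: "orthogonal_projection p \<Longrightarrow> positive_operator p"
  by (auto simp: positive_operator_def orthogonal_projection_form(1)
      intro: orthogonal_projection_sym)

lemma projection_orthogonal_projection: "projection p \<Longrightarrow> orthogonal_projection p"
  unfolding projection_def orthogonal_projection_def
  by (metis inner_adj blinfun_apply_blinfun_compose)

section \<open>Maps with a Kraus decomposition\<close>

text \<open>
  The Kraus decomposition in the weak form that the argument uses.  The indices of \<open>l\<close>
  start at \<open>1\<close>.
\<close>

locale kraus_map =
  fixes A :: "('a::real_inner \<Rightarrow>\<^sub>L 'a) set"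
    and \<tau> :: "('a \<Rightarrow>\<^sub>L 'a) \<Rightarrow> ('a \<Rightarrow>\<^sub>L 'a)"
    and l :: "nat \<Rightarrow> 'a \<Rightarrow>\<^sub>L 'a"
  assumes closed: "x \<in> A \<Longrightarrow> \<tau> x \<in> A"
    and form_sums: "x \<in> A \<Longrightarrow>
      (\<lambda>k. inner (l (Suc k) u) (x (l (Suc k) v))) sums inner u (\<tau> x v)"
begin

lemma form_mono:
  assumes "x \<in> A" "x' \<in> A" and "\<And>v. inner v (x v) \<le> inner v (x' v)"
  shows "inner v (\<tau> x v) \<le> inner v (\<tau> x' v)"
  by (rule sums_le[OF _ form_sums form_sums]) (use assms in auto)

lemma positive:
  assumes x: "x \<in> A" "positive_operator x"
  shows "positive_operator (\<tau> x)"
  unfolding positive_operator_def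
proof (intro conjI allI)
  fix u v
  have "inner (l k v) (x (l k u)) = inner (l k u) (x (l k v))" for k
    by (metis positive_operator_sym[OF x(2)] inner_commute)
  then have "(\<lambda>k. inner (l (Suc k) v) (x (l (Suc k) u))) sums inner u (\<tau> x v)"
    using form_sums[OF x(1), of u v] by simp
  then show "inner u (\<tau> x v) = inner (\<tau> x u) v"
    using sums_unique2[OF form_sums[OF x(1)]] by (metis inner_commute)
  show "0 \<le> inner v (\<tau> x v)"
    by (rule sums_le[OF _ sums_zero form_sums[OF x(1)]])
       (rule positive_operator_nonneg[OF x(2)])
qed

text \<open>A convergent series of nonnegative terms vanishes only if every term does.\<close>

lemma form_eq_zero_iff:
  assumes x: "x \<in> A" "positive_operator x"
  shows "inner v (\<tau> x v) = 0 \<longleftrightarrow> (\<forall>k\<ge>1. inner (l k v) (x (l k v)) = 0)"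
proof -
  note sums = form_sums[OF x(1), of v v]
  have "inner v (\<tau> x v) = 0 \<longleftrightarrow> (\<forall>k. inner (l (Suc k) v) (x (l (Suc k) v)) = 0)"
    using suminf_eq_zero_iff[OF sums_summable[OF sums]] positive_operator_nonneg[OF x(2)]
    by (simp add: sums_unique[OF sums, symmetric])
  then show ?thesis by (metis One_nat_def Suc_le_D le_add1 plus_1_eq_Suc)
qed

lemma iterate_closed: "x \<in> A \<Longrightarrow> (\<tau> ^^ n) x \<in> A"
  by (induction n) (auto simp: closed)

lemma iterate_positive: "x \<in> A \<Longrightarrow> positive_operator x \<Longrightarrow> positive_operator ((\<tau> ^^ n) x)"
  by (induction n) (auto simp: positive iterate_closed)

lemma iterate_form_mono:
  assumes "x \<in> A" and "\<And>v. inner v (x v) \<le> inner v (\<tau> x v)"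
  shows "inner v ((\<tau> ^^ n) x v) \<le> inner v ((\<tau> ^^ Suc n) x v)"
proof (induction n arbitrary: v)
  case (Suc n)
  have "inner v (\<tau> ((\<tau> ^^ n) x) v) \<le> inner v (\<tau> ((\<tau> ^^ Suc n) x) v)"
    by (rule form_mono) (use Suc assms(1) in \<open>auto intro: iterate_closed closed\<close>)
  then show ?case by simp
qed (simp add: assms(2))

text \<open>
  Peeling off the outermost application of \<open>\<tau>\<close> prolongs the word on the right, next to \<open>v\<close>,
  by an arbitrary letter; this is why the induction runs over all \<open>v\<close>.
\<close>

lemma iterate_projection_form_eq_zero_iff:
  assumes p: "p \<in> A" "orthogonal_projection p"
  shows "inner v ((\<tau> ^^ n) p v) = 0 \<longleftrightarrow>
    (\<forall>i :: nat \<Rightarrow> nat. (\<forall>j\<in>{1..n}. i j \<ge> 1) \<longrightarrow> p (foldr (\<lambda>j. l (i j)) [1..<Suc n] v) = 0)"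
proof (induction n arbitrary: v)
  case 0
  show ?case by (simp add: orthogonal_projection_form[OF p(2)])
next
  case (Suc n)
  have "inner v ((\<tau> ^^ Suc n) p v) = 0 \<longleftrightarrow>
      (\<forall>k\<ge>1. inner (l k v) ((\<tau> ^^ n) p (l k v)) = 0)"
    using form_eq_zero_iff[OF iterate_closed[OF p(1)]
        iterate_positive[OF p(1) orthogonal_projection_positive[OF p(2)]]] by simp
  also have "\<dots> \<longleftrightarrow> (\<forall>k\<ge>1. \<forall>i :: nat \<Rightarrow> nat. (\<forall>j\<in>{1..n}. i j \<ge> 1) \<longrightarrow>
      p (foldr (\<lambda>j. l (i j)) [1..<Suc n] (l k v)) = 0)"
    by (simp add: Suc.IH)
  also have "\<dots> \<longleftrightarrow> (\<forall>i :: nat \<Rightarrow> nat. (\<forall>j\<in>{1..Suc n}. i j \<ge> 1) \<longrightarrow>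
      p (foldr (\<lambda>j. l (i j)) [1..<Suc (Suc n)] v) = 0)" (is "?L \<longleftrightarrow> ?R")
  proof
    assume ?L
    then show ?R by simp
  next
    assume R: ?R
    show ?L
    proof (intro allI impI)
      fix k :: nat and i :: "nat \<Rightarrow> nat"
      assume "k \<ge> 1" "\<forall>j\<in>{1..n}. i j \<ge> 1"
      then have "\<forall>j\<in>{1..Suc n}. (i(Suc n := k)) j \<ge> 1" by auto
      with R have "p (foldr (\<lambda>j. l ((i(Suc n := k)) j)) [1..<Suc (Suc n)] v) = 0" by blast
      moreover have "foldr (\<lambda>j. l ((i(Suc n := k)) j)) [1..<Suc n] (l k v)
          = foldr (\<lambda>j. l (i j)) [1..<Suc n] (l k v)"
        by (rule foldr_cong) auto
      ultimately show "p (foldr (\<lambda>j. l (i j)) [1..<Suc n] (l k v)) = 0" by simp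
    qed
  qed
  finally show ?case .
qed

text \<open>
  Monotonicity of the forms turns vanishing of the limit into vanishing of every form, and
  this gives the statement also with the empty word left out.
\<close>

lemma limit_kernel_iff:
  fixes y :: "'a \<Rightarrow>\<^sub>L 'a"
  assumes p: "p \<in> A" "orthogonal_projection p"
    and sub: "\<And>v. inner v (p v) \<le> inner v (\<tau> p v)"
    and lim: "\<And>v. (\<lambda>n. (\<tau> ^^ n) p v) \<longlonglongrightarrow> y v"
  shows "y v = 0 \<longleftrightarrow> (\<forall>n\<ge>1. \<forall>i :: nat \<Rightarrow> nat. (\<forall>j\<in>{1..n}. i j \<ge> 1) \<longrightarrow>
    p (foldr (\<lambda>j. l (i j)) [1..<Suc n] v) = 0)"
proof -
  note pos = iterate_positive[OF p(1) orthogonal_projection_positive[OF p(2)]]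
  have y: "positive_operator y"
    by (rule positive_operator_limit[OF pos lim])
  have form_lim: "(\<lambda>n. inner v ((\<tau> ^^ n) p v)) \<longlonglongrightarrow> inner v (y v)"
    by (intro tendsto_intros lim)
  have "inner v (y v) = 0 \<longleftrightarrow> (\<forall>n\<ge>1. inner v ((\<tau> ^^ n) p v) = 0)"
  proof
    assume "inner v (y v) = 0"
    moreover have "inner v ((\<tau> ^^ n) p v) \<le> inner v (y v)" for n
      by (rule incseq_le[OF _ form_lim]) (intro incseq_SucI iterate_form_mono p sub)
    ultimately show "\<forall>n\<ge>1. inner v ((\<tau> ^^ n) p v) = 0"
      using positive_operator_nonneg[OF pos] by (metis order_antisym)
  next
    assume "\<forall>n\<ge>1. inner v ((\<tau> ^^ n) p v) = 0"
    then have "(\<lambda>n. inner v ((\<tau> ^^ n) p v)) \<longlonglongrightarrow> 0"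
      by (intro tendsto_eventually eventually_sequentiallyI[of 1]) auto
    with form_lim show "inner v (y v) = 0" by (rule LIMSEQ_unique)
  qed
  then show ?thesis
    unfolding positive_operator_kernel[OF y, of v] iterate_projection_form_eq_zero_iff[OF p] .
qed

end

locale unital_kraus_map = kraus_map +
  assumes id_mem: "id_blinfun \<in> A" and unital: "\<tau> id_blinfun = id_blinfun"
begin

text \<open>The Kraus decomposition of \<open>\<tau>(1 - p) = 1 - \<tau>(p)\<close>.\<close>

lemma complement_form_sums:
  assumes "p \<in> A"
  shows "(\<lambda>k. inner (l (Suc k) u) (l (Suc k) v - p (l (Suc k) v))) sums inner u (v - \<tau> p v)"
  using sums_diff[OF form_sums[OF id_mem, of u v] form_sums[OF assms, of u v]]
  by (simp add: unital inner_diff_right)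

lemma le_image_projection_iff:
  assumes p: "p \<in> A" "orthogonal_projection p"
  shows "(\<forall>v. inner v (p v) \<le> inner v (\<tau> p v)) \<longleftrightarrow>
    (\<forall>k\<ge>1. \<forall>v. l k (p v) - p (l k (p v)) = 0)"
proof
  assume sub: "\<forall>v. inner v (p v) \<le> inner v (\<tau> p v)"
  have "l (Suc k) (p v) - p (l (Suc k) (p v)) = 0" for k v
  proof -
    let ?c = "\<lambda>k. (norm (l (Suc k) (p v) - p (l (Suc k) (p v))))\<^sup>2"
    have sums: "?c sums inner (p v) (p v - \<tau> p (p v))"
      using complement_form_sums[OF p(1), of "p v" "p v"]
      by (simp add: orthogonal_projection_form[OF p(2)])
    moreover have "inner (p v) (p v - \<tau> p (p v)) \<le> 0"
      using sub[rule_format, of "p v"] orthogonal_projection_idem[OF p(2)]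
      by (simp add: inner_diff_right)
    moreover have "?c k \<le> suminf ?c"
      using sum_le_suminf[OF sums_summable[OF sums], of "{k}"] by simp
    ultimately have "?c k \<le> 0" by (simp only: sums_unique[OF sums, symmetric])
    then show ?thesis by simp
  qed
  then show "\<forall>k\<ge>1. \<forall>v. l k (p v) - p (l k (p v)) = 0"
    by (metis One_nat_def Suc_le_D le_add1 plus_1_eq_Suc)
next
  assume inv: "\<forall>k\<ge>1. \<forall>v. l k (p v) - p (l k (p v)) = 0"
  have fixed: "\<tau> p (p v) = p v" for v
  proof -
    have "inner u (p v - \<tau> p (p v)) = 0" for u
      using sums_unique2[OF complement_form_sums[OF p(1), of u "p v"]] inv by simp
    then show ?thesis by (metis inner_eq_zero_iff eq_iff_diff_eq_0)
  qed
  note pos = positive[OF p(1) orthogonal_projection_positive[OF p(2)]]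
  show "\<forall>v. inner v (p v) \<le> inner v (\<tau> p v)"
  proof
    fix v
    define w where "w = v - p v"
    have v: "v = p v + w" by (simp add: w_def)
    have wp: "inner w (p v) = 0"
      using orthogonal_projection_form[OF p(2), of v]
      by (simp add: w_def inner_diff_left power2_norm_eq_inner)
    have pw: "inner (p v) (\<tau> p w) = 0"
      using wp by (metis positive_operator_sym[OF pos] fixed inner_commute)
    have "inner v (\<tau> p v) = inner (p v + w) (\<tau> p (p v + w))" using v by simp
    also have "\<dots> = inner (p v) (p v) + inner w (\<tau> p w)"
      by (simp add: blinfun.add_right inner_add_left inner_add_right fixed wp pw)
    finally show "inner v (p v) \<le> inner v (\<tau> p v)"
      using positive_operator_nonneg[OF pos, of w] orthogonal_projection_form(1)[OF p(2), of v]
      by (simp add: power2_norm_eq_inner)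
  qed
qed

end

section \<open>Sub-harmonic projections\<close>

lemma strong_operator_limit_pointwise:
  assumes "limitin strong_operator_topology S T F"
  shows "((\<lambda>n. S n v) \<longlongrightarrow> T v) F"
  using continuous_map_limit[OF strong_operator_topology_continuous_evaluation assms, of v]
  by (simp add: comp_def)

lemma blinfun_eq_zero_iff: "T = 0 \<longleftrightarrow> (\<forall>h. blinfun_apply T h = 0)"
  by (metis blinfun_eqI zero_blinfun.rep_eq)

lemma foldr_blinfun_compose_apply:
  "foldr (\<lambda>j T. l (i j) o\<^sub>L T) js z h = foldr (\<lambda>j. l (i j)) js (z h)"
  by (induction js) auto

theorem theorem2p7:
  fixes A :: "'h::complex_hilbert_space operator set"
    and \<tau> :: "'h operator \<Rightarrow> 'h operator"
    and l :: "nat \<Rightarrow> 'h operator"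
    and p :: "'h operator"
  assumes separable: "separable_space (euclidean :: 'h topology)"
    and vN: "von_neumann_algebra A"
    and linear: "linear_map_on A \<tau>"
    and unital: "\<tau> id_blinfun = id_blinfun"
    and cp: "completely_positive_on A \<tau>"
    and normal: "normal_on A \<tau>"
    and l_bounded: "\<And>k. k \<ge> 1 \<Longrightarrow> l k \<in> bounded_ops"
    and kraus: "\<And>x. x \<in> A \<Longrightarrow>
      limitin strong_operator_topology (\<lambda>n. \<Sum>k=1..n. adj (l k) o\<^sub>L x o\<^sub>L l k) (\<tau> x) sequentially"
    and p_in: "p \<in> A"
    and p_proj: "projection p"
  shows "(subharmonic \<tau> p \<longleftrightarrow> (\<forall>k\<ge>1. (id_blinfun - p) o\<^sub>L l k o\<^sub>L p = 0)) \<and>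
    (subharmonic \<tau> p \<longrightarrow>
      (\<forall>y. limitin strong_operator_topology (\<lambda>n. (\<tau> ^^ n) p) y sequentially \<longrightarrow>
        (\<forall>z\<in>bounded_ops. y o\<^sub>L z = 0 \<longleftrightarrow>
          (\<forall>n\<ge>1. \<forall>i :: nat \<Rightarrow> nat. (\<forall>j\<in>{1..n}. i j \<ge> 1) \<longrightarrow>
            p o\<^sub>L foldr (\<lambda>j T. l (i j) o\<^sub>L T) [1..<Suc n] z = 0))))"
proof -
  interpret unital_kraus_map A \<tau> l
  proof
    show "\<tau> x \<in> A" if "x \<in> A" for x
      using linear that by (auto simp: linear_map_on_def)
    show "id_blinfun \<in> A" using vN by (simp add: von_neumann_algebra_def)
    show "\<tau> id_blinfun = id_blinfun" by fact
    fix x u v assume x: "x \<in> A"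
    have "(\<lambda>n. inner u ((\<Sum>k=1..n. adj (l k) o\<^sub>L x o\<^sub>L l k) v)) \<longlonglongrightarrow> inner u (\<tau> x v)"
      by (intro tendsto_intros strong_operator_limit_pointwise kraus[OF x])
    moreover have "inner u ((adj (l (Suc k)) o\<^sub>L x o\<^sub>L l (Suc k)) v) =
        inner (l (Suc k) u) (x (l (Suc k) v))" for k
      using inner_adj[OF l_bounded, of "Suc k"] by (simp add: inner_commute)
    ultimately show "(\<lambda>k. inner (l (Suc k) u) (x (l (Suc k) v))) sums inner u (\<tau> x v)"
      by (simp add: sums_def blinfun.sum_left inner_sum_right sum.atLeast1_atMost_eq)
  qed
  have p: "orthogonal_projection p" using p_proj by (rule projection_orthogonal_projection)
  note pos = positive[OF p_in orthogonal_projection_positive[OF p]]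
  have sub_iff: "subharmonic \<tau> p \<longleftrightarrow> (\<forall>v. inner v (p v) \<le> inner v (\<tau> p v))"
  proof -
    have "\<tau> p - p \<in> bounded_ops"
      using vN p_in closed[OF p_in] by (auto simp: von_neumann_algebra_def intro!: bounded_ops_diff)
    moreover have "inner u ((\<tau> p - p) v) = inner ((\<tau> p - p) u) v" for u v
      by (simp add: blinfun.diff_left inner_simps positive_operator_sym[OF pos]
          orthogonal_projection_sym[OF p])
    ultimately have "op_pos (\<tau> p - p) \<longleftrightarrow> (\<forall>v. 0 \<le> inner v ((\<tau> p - p) v))"
      by (rule op_pos_iff_inner_nonneg)
    then show ?thesis
      by (simp add: subharmonic_def op_le_def blinfun.diff_left inner_diff_right)
  qed
  have "subharmonic \<tau> p \<longleftrightarrow> (\<forall>k\<ge>1. (id_blinfun - p) o\<^sub>L l k o\<^sub>L p = 0)"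
    unfolding sub_iff le_image_projection_iff[OF p_in p]
    by (simp add: blinfun_eq_zero_iff blinfun.diff_left)
  moreover have "y o\<^sub>L z = 0 \<longleftrightarrow>
      (\<forall>n\<ge>1. \<forall>i :: nat \<Rightarrow> nat. (\<forall>j\<in>{1..n}. i j \<ge> 1) \<longrightarrow>
        p o\<^sub>L foldr (\<lambda>j T. l (i j) o\<^sub>L T) [1..<Suc n] z = 0)"
    if sub: "subharmonic \<tau> p"
      and lim: "limitin strong_operator_topology (\<lambda>n. (\<tau> ^^ n) p) y sequentially"
    for y z :: "'h operator"
  proof -
    have "y (z h) = 0 \<longleftrightarrow> (\<forall>n\<ge>1. \<forall>i :: nat \<Rightarrow> nat. (\<forall>j\<in>{1..n}. i j \<ge> 1) \<longrightarrow>
        p (foldr (\<lambda>j. l (i j)) [1..<Suc n] (z h)) = 0)" for h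
      using sub lim
      by (intro limit_kernel_iff p_in p) (auto simp: sub_iff strong_operator_limit_pointwise)
    then show ?thesis
      unfolding blinfun_eq_zero_iff blinfun_apply_blinfun_compose
        foldr_blinfun_compose_apply by blast
  qed
  ultimately show ?thesis by blast
qed

end
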